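(* Let $f$ be a (real-valued) measurable function on $\mathbb{R}^n$ and let $Q_0$ be a fixed cube. Then there exists a (possibly empty) sparse family of cubes $Q_j^k\in\mathcal{D}(Q_0)$ such that for a.e. $x\in Q_0$, $$|f(x)-m_f(Q_0)|\le 4M_{\frac1{2^{n+2}};Q_0}^{\#,d}f(x)+2\sum_{k,j}\omega_{\frac1{2^{n+2}}}(f;Q_j^k)\chi_{Q_j^k}(x).$$
   Context: $\mathcal{D}(Q_0)$ is the set of all dyadic cubes with respect to $Q_0$, i.e. $Q_0$ and all cubes obtained by repeatedly dividing $Q_0$ into $2^n$ equal subcubes. A family $\{Q_j^k\}\subset\mathcal{D}(Q_0)$ is sparse if: (i) for fixed $k$ the cubes $Q_j^k$ are pairwise disjoint in $j$; (ii) with $\Omega_k=\bigcup_jQ_j^k$, $\Omega_{k+1}\subset\Omega_k$; (iii) $|\Omega_{k+1}\cap Q_j^k|\le\frac12|Q_j^k|$. Non-increasing rearrangement: $f^*(t)=\inf\{\alpha>0:|\{x\in\mathbb{R}^n:|f(x)|>\alpha\}|<t\}$, $0<t<\infty$. Local mean oscillation of $f$ on a cube $Q$: $\omega_{\lambda}(f;Q)=\inf_{c\in\mathbb{R}}\big((f-c)\chi_Q\big)^*(\lambda|Q|)$, $0<\lambda<1$. Median value: a real number $m_f(Q)$ such that $\max\big(|\{x\in Q:f(x)>m_f(Q)\}|,|\{x\in Q:f(x)<m_f(Q)\}|\big)\le|Q|/2$; if it is not unique, $m_f(Q)$ denotes the maximal median value. Dyadic local sharp maximal function: $M^{\#,d}_{\lambda;Q_0}f(x)=\sup_{x\in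 Q'\in\mathcal{D}(Q_0)}\omega_{\lambda}(f;Q')$. *)

theory Defs
  imports "HOL-Analysis.Analysis"
begin

text \<open>
  Cubes have sides parallel to the axes and are taken half-open, so that the \<open>2\<^sup>n\<close> subcubes of a
  cube partition it and ``pairwise disjoint'' can be read literally.
\<close>

definition cube :: "real ^ 'n \<Rightarrow> real \<Rightarrow> (real ^ 'n) set" where
  "cube a l = {x. \<forall>i. a $ i \<le> x $ i \<and> x $ i < a $ i + l}"

definition is_cube :: "(real ^ 'n) set \<Rightarrow> bool" where
  "is_cube Q \<longleftrightarrow> (\<exists>a l. l > 0 \<and> Q = cube a l)"

inductive_set dyadic_cubes :: "(real ^ 'n) set \<Rightarrow> (real ^ 'n) set set"
  for Q0 :: "(real ^ 'n) set" where
  root: "Q0 \<in> dyadic_cubes Q0"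
| divide: "cube a l \<in> dyadic_cubes Q0 \<Longrightarrow> l > 0 \<Longrightarrow>
    (\<And>i. b $ i = a $ i \<or> b $ i = a $ i + l / 2) \<Longrightarrow> cube b (l / 2) \<in> dyadic_cubes Q0"

text \<open>
  The family \<open>Q\<^sub>j\<^sup>k\<close> is given by \<open>Q k j\<close> for \<open>j \<in> J k\<close>. The index sets may be empty, finite or
  infinite and may depend on \<open>k\<close>; in particular the empty family is allowed. Natural numbers
  suffice as indices, as disjoint cubes are at most countably many.
\<close>

definition level_union :: "(nat \<Rightarrow> nat set) \<Rightarrow> (nat \<Rightarrow> nat \<Rightarrow> (real ^ 'n) set) \<Rightarrow> nat \<Rightarrow> (real ^ 'n) set"
  where "level_union J Q k = (\<Union>j\<in>J k. Q k j)"

definition sparse_family ::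
  "(real ^ 'n) set \<Rightarrow> (nat \<Rightarrow> nat set) \<Rightarrow> (nat \<Rightarrow> nat \<Rightarrow> (real ^ 'n) set) \<Rightarrow> bool" where
  "sparse_family Q0 J Q \<longleftrightarrow>
     (\<forall>k. \<forall>j\<in>J k. Q k j \<in> dyadic_cubes Q0) \<and>
     (\<forall>k. disjoint_family_on (Q k) (J k)) \<and>
     (\<forall>k. level_union J Q (Suc k) \<subseteq> level_union J Q k) \<and>
     (\<forall>k. \<forall>j\<in>J k.
        measure lebesgue (level_union J Q (Suc k) \<inter> Q k j) \<le> 1 / 2 * measure lebesgue (Q k j))"

text \<open>
  The next quantities take values in the extended non-negative reals: the infimum of the empty set
  is \<open>\<infinity>\<close>, and the maximal function may be infinite.
\<close>

definition rearrangement :: "(real ^ 'n \<Rightarrow> real) \<Rightarrow> real \<Rightarrow> ennreal" where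
  "rearrangement f t =
     (INF \<alpha> \<in> {\<alpha>. \<alpha> > 0 \<and> emeasure lebesgue {x. \<bar>f x\<bar> > \<alpha>} < ennreal t}. ennreal \<alpha>)"

definition local_osc :: "real \<Rightarrow> (real ^ 'n \<Rightarrow> real) \<Rightarrow> (real ^ 'n) set \<Rightarrow> ennreal" where
  "local_osc lam f Q =
     (INF c. rearrangement (\<lambda>x. (f x - c) * indicator Q x) (lam * measure lebesgue Q))"

definition is_median :: "(real ^ 'n \<Rightarrow> real) \<Rightarrow> (real ^ 'n) set \<Rightarrow> real \<Rightarrow> bool" where
  "is_median f Q m \<longleftrightarrow>
     max (measure lebesgue {x \<in> Q. f x > m}) (measure lebesgue {x \<in> Q. f x < m})
       \<le> measure lebesgue Q / 2"

definition median :: "(real ^ 'n \<Rightarrow> real) \<Rightarrow> (real ^ 'n) set \<Rightarrow> real" where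
  "median f Q = (GREATEST m. is_median f Q m)"

definition dyadic_sharp_max ::
  "real \<Rightarrow> (real ^ 'n) set \<Rightarrow> (real ^ 'n \<Rightarrow> real) \<Rightarrow> real ^ 'n \<Rightarrow> ennreal" where
  "dyadic_sharp_max lam Q0 f x = (SUP Q \<in> {Q \<in> dyadic_cubes Q0. x \<in> Q}. local_osc lam f Q)"

end

theory Submission
  imports Defs
begin

text \<open>
  Write \<open>\<omega>(L)\<close> for the local mean oscillation on \<open>L\<close> with parameter \<open>2 powr (- n - 2)\<close>. By
  definition of \<open>\<omega>(L)\<close> the set \<open>E = {x \<in> L. 2 \<omega>(L) < \<bar>f x - m(L)\<bar>}\<close> has measure at most
  \<open>2 powr (- n - 2) |L|\<close>. The next generation below \<open>L\<close> consists of the maximal dyadic cubes having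
  a child \<open>L'\<close> with \<open>2 \<omega>(L) < \<bar>m(L') - m(L)\<bar>\<close>. At least half of such a child lies in \<open>E\<close>, so these
  cubes cover at most half of \<open>L\<close>. Maximality gives \<open>\<bar>m(Q) - m(L)\<bar> \<le> 2 \<omega>(L)\<close> for every selected
  \<open>Q\<close>. Off the selected cubes all medians satisfy this bound, hence \<open>E\<close> has density at most \<open>1/2\<close>
  on each side of \<open>m(L)\<close> in all cubes, and so is null there. Telescoping along the chain of selected
  cubes, which is finite almost everywhere, bounds \<open>\<bar>f x - m(Q0)\<bar>\<close> by twice the sum of the
  oscillations.
\<close>

subsection \<open>Medians and local oscillation\<close>

lemma lmeasurable_Collect_in:
  fixes f :: "real ^ 'n \<Rightarrow> real"
  assumes f: "f \<in> borel_measurable lebesgue" and Q: "Q \<in> lmeasurable" and B: "B \<in> sets borel"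
  shows "{x \<in> Q. f x \<in> B} \<in> lmeasurable"
proof -
  have "{x \<in> Q. f x \<in> B} = Q \<inter> f -` B" by auto
  moreover have "f -` B \<in> sets lebesgue"
    using measurable_sets[OF f B] by simp
  ultimately show ?thesis
    using fmeasurable_Int_fmeasurable[OF Q] by simp
qed

lemma measure_Collect_Compl:
  assumes Q: "Q \<in> lmeasurable" and "{x \<in> Q. P x} \<in> lmeasurable"
  shows "measure lebesgue {x \<in> Q. \<not> P x} = measure lebesgue Q - measure lebesgue {x \<in> Q. P x}"
proof -
  have "{x \<in> Q. \<not> P x} = Q - {x \<in> Q. P x}" by auto
  then show ?thesis
    using assms by (auto intro: measurable_measure_Diff)
qed

text \<open>Continuity from below along the thresholds \<open>t + 1 / Suc i\<close>. It lets bounds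
  be proved with a margin \<open>e\<close>, where near-optimal values can be used in place of an
  attained infimum or supremum.\<close>

lemma measure_superlevel_le:
  fixes g :: "real ^ 'n \<Rightarrow> real"
  assumes g: "g \<in> borel_measurable lebesgue" and Q: "Q \<in> lmeasurable"
    and le: "\<And>e. e > 0 \<Longrightarrow> measure lebesgue {x \<in> Q. g x > t + e} \<le> b"
  shows "measure lebesgue {x \<in> Q. g x > t} \<le> b"
proof -
  let ?A = "\<lambda>i. {x \<in> Q. g x > t + 1 / Suc i}"
  have gt: "{x \<in> Q. g x > s} \<in> lmeasurable" for s
    using lmeasurable_Collect_in[OF g Q, of "{s<..}"] by simp
  have "(\<lambda>i. measure lebesgue (?A i)) \<longlonglongrightarrow> measure lebesgue (\<Union>i. ?A i)"
  proof (rule Lim_measure_incseq)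
    show "incseq ?A"
    proof (intro monoI subsetI)
      fix i j :: nat and x assume "i \<le> j" "x \<in> ?A i"
      moreover from \<open>i \<le> j\<close> have "1 / real (Suc j) \<le> 1 / Suc i" by (simp add: frac_le)
      ultimately show "x \<in> ?A j" by auto
    qed
    have "emeasure lebesgue (\<Union>i. ?A i) \<le> emeasure lebesgue Q"
      by (rule emeasure_mono) (use Q in auto)
    then show "emeasure lebesgue (\<Union>i. ?A i) \<noteq> \<infinity>"
      using fmeasurableD2[OF Q] by (auto simp: top_unique)
  qed (use gt in auto)
  also have "(\<Union>i. ?A i) = {x \<in> Q. g x > t}"
  proof (intro equalityI subsetI)
    fix x assume "x \<in> {x \<in> Q. g x > t}"
    then obtain i where "1 / real (Suc i) < g x - t"
      using nat_approx_posE[of "g x - t"] by auto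
    then have "g x > t + 1 / Suc i" by linarith
    with \<open>x \<in> _\<close> show "x \<in> (\<Union>i. ?A i)" by blast
  next
    fix x assume "x \<in> (\<Union>i. ?A i)"
    then obtain i where "x \<in> Q" "g x > t + 1 / Suc i" by auto
    moreover have "0 < 1 / real (Suc i)" by simp
    ultimately have "t < g x" by linarith
    with \<open>x \<in> Q\<close> show "x \<in> {x \<in> Q. g x > t}" by simp
  qed
  finally show ?thesis
    by (rule LIMSEQ_le_const2) (use le in auto)
qed

text \<open>The superlevel sets at integer thresholds decrease to the empty set because
  \<open>g\<close> takes finite values; finite measure of \<open>Q\<close> gives continuity from
  above.\<close>

lemma measure_superlevel_small:
  fixes g :: "real ^ 'n \<Rightarrow> real"
  assumes g: "g \<in> borel_measurable lebesgue" and Q: "Q \<in> lmeasurable" and "b > 0"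
  shows "\<exists>K. measure lebesgue {x \<in> Q. g x > K} < b"
proof -
  let ?A = "\<lambda>i. {x \<in> Q. g x > real i}"
  have gt: "{x \<in> Q. g x > s} \<in> lmeasurable" for s
    using lmeasurable_Collect_in[OF g Q, of "{s<..}"] by simp
  have "(\<lambda>i. measure lebesgue (?A i)) \<longlonglongrightarrow> measure lebesgue (\<Inter>i. ?A i)"
    by (rule Lim_measure_decseq) (use gt fmeasurableD2[OF gt] in \<open>auto simp: decseq_def\<close>)
  also have "(\<Inter>i. ?A i) = {}"
  proof -
    have "x \<notin> (\<Inter>i. ?A i)" for x
      using reals_Archimedean2[of "g x"] by (force dest: less_asym)
    then show ?thesis by blast
  qed
  finally have "(\<lambda>i. measure lebesgue (?A i)) \<longlonglongrightarrow> 0" by simp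
  then have "\<forall>\<^sub>F i in sequentially. measure lebesgue (?A i) < b"
    by (rule order_tendstoD) (use \<open>b > 0\<close> in auto)
  then show ?thesis
    using eventually_happens'[OF sequentially_bot] by blast
qed

text \<open>As \<open>median\<close> is given by \<open>GREATEST\<close>, a maximal median has to be
  exhibited. It is the supremum of \<open>S\<close>, which records only the condition on sublevel
  sets: that condition survives the limit from below, while the one on superlevel sets holds because
  no \<open>M + e\<close> lies in \<open>S\<close>.\<close>

lemma is_median_median:
  fixes f :: "real ^ 'n \<Rightarrow> real"
  assumes f: "f \<in> borel_measurable lebesgue" and Q: "Q \<in> lmeasurable"
    and pos: "measure lebesgue Q > 0"
  shows "is_median f Q (median f Q)"
proof -
  let ?\<mu> = "measure lebesgue"
  define S where "S = {m. ?\<mu> {x \<in> Q. f x < m} \<le> ?\<mu> Q / 2}"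
  have nf: "(\<lambda>x. - f x) \<in> borel_measurable lebesgue" using f by simp
  have lt: "{x \<in> Q. f x < m} \<in> lmeasurable" for m
    using lmeasurable_Collect_in[OF f Q, of "{..<m}"] by simp
  have le: "{x \<in> Q. f x \<le> m} \<in> lmeasurable" for m
    using lmeasurable_Collect_in[OF f Q, of "{..m}"] by simp
  have gt: "{x \<in> Q. f x > m} \<in> lmeasurable" for m
    using lmeasurable_Collect_in[OF f Q, of "{m<..}"] by simp
  obtain K' where "?\<mu> {x \<in> Q. - f x > K'} < ?\<mu> Q / 2"
    using measure_superlevel_small[OF nf Q half_gt_zero[OF pos]] by blast
  moreover have "{x \<in> Q. - f x > K'} = {x \<in> Q. f x < - K'}" by auto
  ultimately have "- K' \<in> S"
    unfolding S_def by simp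
  then have ne: "S \<noteq> {}" by auto
  obtain K where "?\<mu> {x \<in> Q. f x > K} < ?\<mu> Q / 2"
    using measure_superlevel_small[OF f Q half_gt_zero[OF pos]] by blast
  then have K: "?\<mu> {x \<in> Q. f x \<le> K} > ?\<mu> Q / 2"
    using measure_Collect_Compl[OF Q gt[of K]] by (simp add: not_less)
  have "m \<le> K" if "m \<in> S" for m
  proof (rule ccontr)
    assume "\<not> m \<le> K"
    then have "?\<mu> {x \<in> Q. f x \<le> K} \<le> ?\<mu> {x \<in> Q. f x < m}"
      by (intro measure_mono_fmeasurable lt fmeasurableD le) auto
    then show False using that K by (simp add: S_def)
  qed
  then have bdd: "bdd_above S" by (auto simp: bdd_above_def)
  define M where "M = Sup S"
  have "?\<mu> {x \<in> Q. - f x > - M} \<le> ?\<mu> Q / 2"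
  proof (rule measure_superlevel_le[OF nf Q])
    fix e :: real assume "e > 0"
    then obtain m where "m \<in> S" "M - e < m"
      using less_cSup_iff[OF ne bdd, of "M - e"] by (auto simp: M_def)
    then have "?\<mu> {x \<in> Q. - f x > - M + e} \<le> ?\<mu> {x \<in> Q. f x < m}"
      using lmeasurable_Collect_in[OF nf Q, of "{- M + e<..}"]
      by (intro measure_mono_fmeasurable lt fmeasurableD) auto
    then show "?\<mu> {x \<in> Q. - f x > - M + e} \<le> ?\<mu> Q / 2"
      using \<open>m \<in> S\<close> by (simp add: S_def)
  qed
  moreover have "?\<mu> {x \<in> Q. f x > M} \<le> ?\<mu> Q / 2"
  proof (rule measure_superlevel_le[OF f Q])
    fix e :: real assume "e > 0"
    then have "M + e \<notin> S"
      using cSup_upper[OF _ bdd, of "M + e"] by (auto simp: M_def)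
    then have "?\<mu> {x \<in> Q. \<not> f x < M + e} \<le> ?\<mu> Q / 2"
      unfolding measure_Collect_Compl[OF Q lt] S_def by simp
    moreover have "?\<mu> {x \<in> Q. f x > M + e} \<le> ?\<mu> {x \<in> Q. \<not> f x < M + e}"
      using lmeasurable_Collect_in[OF f Q, of "{M + e..}"]
      by (intro measure_mono_fmeasurable fmeasurableD gt) (auto simp: not_less)
    ultimately show "?\<mu> {x \<in> Q. f x > M + e} \<le> ?\<mu> Q / 2" by simp
  qed
  ultimately have "is_median f Q M"
    by (simp add: is_median_def)
  moreover have "m \<le> M" if "is_median f Q m" for m
    using that cSup_upper[OF _ bdd, of m] by (simp add: M_def is_median_def S_def)
  ultimately show ?thesis
    unfolding median_def by (rule GreatestI2_order) auto
qed

lemma measure_median_le: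
  fixes f :: "real ^ 'n \<Rightarrow> real"
  assumes f: "f \<in> borel_measurable lebesgue" and Q: "Q \<in> lmeasurable"
    and pos: "measure lebesgue Q > 0"
  shows "measure lebesgue Q / 2 \<le> measure lebesgue {x \<in> Q. f x \<le> median f Q}"
proof -
  have "measure lebesgue {x \<in> Q. f x > median f Q} \<le> measure lebesgue Q / 2"
    using is_median_median[OF assms] by (simp add: is_median_def)
  then show ?thesis
    using measure_Collect_Compl[OF Q, of "\<lambda>x. f x > median f Q"]
      lmeasurable_Collect_in[OF f Q, of "{median f Q<..}"]
    by (simp add: not_less)
qed

lemma measure_median_ge:
  fixes f :: "real ^ 'n \<Rightarrow> real"
  assumes f: "f \<in> borel_measurable lebesgue" and Q: "Q \<in> lmeasurable"
    and pos: "measure lebesgue Q > 0"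
  shows "measure lebesgue Q / 2 \<le> measure lebesgue {x \<in> Q. f x \<ge> median f Q}"
proof -
  have "measure lebesgue {x \<in> Q. f x < median f Q} \<le> measure lebesgue Q / 2"
    using is_median_median[OF assms] by (simp add: is_median_def)
  then show ?thesis
    using measure_Collect_Compl[OF Q, of "\<lambda>x. f x < median f Q"]
      lmeasurable_Collect_in[OF f Q, of "{..<median f Q}"]
    by (simp add: not_less)
qed

lemma measure_median_ge_above:
  fixes f :: "real ^ 'n \<Rightarrow> real"
  assumes f: "f \<in> borel_measurable lebesgue" and Q: "Q \<in> lmeasurable"
    and pos: "measure lebesgue Q > 0" and lt: "t < median f Q"
  shows "measure lebesgue Q / 2 \<le> measure lebesgue {x \<in> Q. t < f x}"
proof -
  have "measure lebesgue {x \<in> Q. f x \<ge> median f Q} \<le> measure lebesgue {x \<in> Q. t < f x}"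
    using lmeasurable_Collect_in[OF f Q, of "{t<..}"] lmeasurable_Collect_in[OF f Q, of "{median f Q..}"] lt
    by (intro measure_mono_fmeasurable fmeasurableD) auto
  then show ?thesis using measure_median_ge[OF f Q pos] by simp
qed

lemma measure_median_ge_below:
  fixes f :: "real ^ 'n \<Rightarrow> real"
  assumes f: "f \<in> borel_measurable lebesgue" and Q: "Q \<in> lmeasurable"
    and pos: "measure lebesgue Q > 0" and lt: "median f Q < t"
  shows "measure lebesgue Q / 2 \<le> measure lebesgue {x \<in> Q. f x < t}"
proof -
  have "measure lebesgue {x \<in> Q. f x \<le> median f Q} \<le> measure lebesgue {x \<in> Q. f x < t}"
    using lmeasurable_Collect_in[OF f Q, of "{..<t}"] lmeasurable_Collect_in[OF f Q, of "{..median f Q}"] lt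
    by (intro measure_mono_fmeasurable fmeasurableD) auto
  then show ?thesis using measure_median_le[OF f Q pos] by simp
qed

text \<open>The factor 2 is the price for replacing a near-optimal constant \<open>c\<close> by the
  median. If the median were further than \<open>\<alpha>\<close> from \<open>c\<close>, at least
  half of \<open>Q\<close> would be too, against \<open>lam \<le> 1 / 2\<close>; so a deviation
  above \<open>2 * \<alpha>\<close> from the median forces one above \<open>\<alpha>\<close> from
  \<open>c\<close>.\<close>

lemma measure_dev_le_osc:
  fixes f :: "real ^ 'n \<Rightarrow> real"
  assumes f: "f \<in> borel_measurable lebesgue" and Q: "Q \<in> lmeasurable"
    and pos: "measure lebesgue Q > 0" and lam: "0 < lam" "lam \<le> 1 / 2"
  shows "measure lebesgue {x \<in> Q. 2 * local_osc lam f Q < ennreal \<bar>f x - median f Q\<bar>} \<le> lam * measure lebesgue Q"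
proof (cases "local_osc lam f Q")
  case top
  then show ?thesis using lam by (simp add: ennreal_mult_top)
next
  case (real w)
  let ?m = "median f Q" and ?\<mu> = "measure lebesgue"
  have g: "(\<lambda>x. \<bar>f x - ?m\<bar>) \<in> borel_measurable lebesgue" using f by simp
  have "?\<mu> {x \<in> Q. 2 * w < \<bar>f x - ?m\<bar>} \<le> lam * ?\<mu> Q"
  proof (rule measure_superlevel_le[OF g Q])
    fix e :: real assume "e > 0"
    \<comment> \<open>Half of the margin, since \<open>\<alpha>\<close> gets doubled:
      \<open>2 * (w + e / 2) = 2 * w + e\<close>.\<close>
    then have "local_osc lam f Q < ennreal (w + e / 2)"
      using real by (simp add: ennreal_lessI)
    then obtain c \<alpha> where \<alpha>: "\<alpha> > 0" "ennreal \<alpha> < ennreal (w + e / 2)"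
      and small: "emeasure lebesgue {x. \<bar>(f x - c) * indicator Q x\<bar> > \<alpha>} < ennreal (lam * ?\<mu> Q)"
      unfolding local_osc_def rearrangement_def by (auto simp: INF_less_iff)
    have "\<alpha> < w + e / 2"
      using \<alpha> by (simp add: ennreal_less_iff)
    have "{x. \<bar>(f x - c) * indicator Q x\<bar> > \<alpha>} = {x \<in> Q. \<bar>f x - c\<bar> > \<alpha>}"
      using \<alpha> by (auto simp: indicator_def)
    moreover have A: "{x \<in> Q. \<bar>f x - c\<bar> > \<alpha>} \<in> lmeasurable"
      using lmeasurable_Collect_in[of "\<lambda>x. \<bar>f x - c\<bar>" Q "{\<alpha><..}"] f Q by simp
    ultimately have A_lt: "?\<mu> {x \<in> Q. \<bar>f x - c\<bar> > \<alpha>} < lam * ?\<mu> Q"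
      using small by (simp add: emeasure_eq_measure2 ennreal_less_iff)
    have lam': "lam * ?\<mu> Q \<le> ?\<mu> Q / 2" using lam pos mult_right_mono[of lam "1/2" "?\<mu> Q"] by simp
    have "\<bar>?m - c\<bar> \<le> \<alpha>"
    proof (rule ccontr)
      assume "\<not> \<bar>?m - c\<bar> \<le> \<alpha>"
      then consider "c + \<alpha> < ?m" | "?m < c - \<alpha>" by linarith
      then have "?\<mu> Q / 2 \<le> ?\<mu> {x \<in> Q. \<bar>f x - c\<bar> > \<alpha>}"
      proof cases
        case 1
        have "?\<mu> {x \<in> Q. c + \<alpha> < f x} \<le> ?\<mu> {x \<in> Q. \<bar>f x - c\<bar> > \<alpha>}"
          using lmeasurable_Collect_in[OF f Q, of "{c + \<alpha><..}"]
          by (intro measure_mono_fmeasurable A fmeasurableD) auto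
        with measure_median_ge_above[OF f Q pos 1] show ?thesis by simp
      next
        case 2
        have "?\<mu> {x \<in> Q. f x < c - \<alpha>} \<le> ?\<mu> {x \<in> Q. \<bar>f x - c\<bar> > \<alpha>}"
          using lmeasurable_Collect_in[OF f Q, of "{..<c - \<alpha>}"]
          by (intro measure_mono_fmeasurable A fmeasurableD) auto
        with measure_median_ge_below[OF f Q pos 2] show ?thesis by simp
      qed
      then show False using A_lt lam' by linarith
    qed
    then have "?\<mu> {x \<in> Q. 2 * w + e < \<bar>f x - ?m\<bar>} \<le> ?\<mu> {x \<in> Q. \<bar>f x - c\<bar> > \<alpha>}"
      using lmeasurable_Collect_in[OF g Q, of "{2 * w + e<..}"] \<open>\<alpha> < w + e / 2\<close>
      by (intro measure_mono_fmeasurable A fmeasurableD) auto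
    then show "?\<mu> {x \<in> Q. 2 * w + e < \<bar>f x - ?m\<bar>} \<le> lam * ?\<mu> Q"
      using A_lt by simp
  qed
  moreover have "2 * local_osc lam f Q = ennreal (2 * w)"
    using real by (simp add: ennreal_mult')
  ultimately show ?thesis
    using real by (simp add: ennreal_less_iff)
qed

subsection \<open>Dyadic grids\<close>

text \<open>A half-open cube lies between an open box and its closure, which differ by a negligible
  frontier.\<close>

lemma
  assumes "l > 0"
  shows cube_lmeasurable: "cube a l \<in> lmeasurable"
    and measure_cube: "measure lebesgue (cube a l :: (real ^ 'n) set) = l ^ CARD('n)"
proof -
  define b where "b = (\<chi> i. a $ i + l)"
  have sub: "box a b \<subseteq> cube a l" "cube a l \<subseteq> cbox a b"
    by (auto simp: cube_def b_def mem_box_cart less_imp_le)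
  have "negligible (cube a l - box a b)"
    by (rule negligible_subset[OF negligible_frontier_interval[of a b]]) (use sub in auto)
  then have "cube a l - box a b \<in> lmeasurable"
    by (rule negligible_imp_measurable)
  then have "box a b \<union> (cube a l - box a b) \<in> lmeasurable"
    by (intro fmeasurable.Un) auto
  moreover have "box a b \<union> (cube a l - box a b) = cube a l"
    using sub by auto
  ultimately show L: "cube a l \<in> lmeasurable" by simp
  have "measure lebesgue (box a b) \<le> measure lebesgue (cube a l)"
    by (rule measure_mono_fmeasurable) (use sub L in auto)
  moreover have "measure lebesgue (cube a l) \<le> measure lebesgue (cbox a b)"
    by (rule measure_mono_fmeasurable) (use sub L in auto)
  moreover have "measure lebesgue (box a b) = measure lebesgue (cbox a b)"
    by (simp add: measure_def emeasure_lborel_box_eq emeasure_lborel_cbox_eq)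
  moreover have "cbox a b \<noteq> {}"
    using \<open>l > 0\<close> by (auto simp: interval_ne_empty_cart b_def)
  then have "measure lebesgue (cbox a b) = l ^ CARD('n)"
    by (simp add: content_cbox_cart b_def)
  ultimately show "measure lebesgue (cube a l) = l ^ CARD('n)" by simp
qed

locale dyadic_grid =
  fixes a :: "real ^ 'n" and l :: real
  assumes l_pos: "l > 0"
begin

text \<open>The cube of generation \<open>g\<close> containing \<open>x\<close> is the class of \<open>x\<close> under an equivalence
  relation that becomes finer with \<open>g\<close>. The grid covers the whole space, not only \<open>cube a l\<close>.\<close>

definition D :: "nat \<Rightarrow> real ^ 'n \<Rightarrow> (real ^ 'n) set" where
  "D g x = {y. \<forall>i. \<lfloor>2 ^ g * (y $ i - a $ i) / l\<rfloor> = \<lfloor>2 ^ g * (x $ i - a $ i) / l\<rfloor>}"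

lemma D_refl [simp]: "x \<in> D g x"
  by (simp add: D_def)

lemma D_cong: "y \<in> D g x \<Longrightarrow> D g y = D g x"
  by (auto simp: D_def)

lemma D_Suc_subset: "D (Suc g) x \<subseteq> D g x"
proof
  fix y assume y: "y \<in> D (Suc g) x"
  \<comment> \<open>Integer division by 2 recovers the coordinates of a cube from those of any of
    its children.\<close>
  have half: "\<lfloor>u\<rfloor> = \<lfloor>2 * u\<rfloor> div 2" for u :: real
    using floor_divide_real_eq_div[of 2 "2 * u"] by simp
  have "\<lfloor>2 ^ g * (y $ i - a $ i) / l\<rfloor> = \<lfloor>2 ^ g * (x $ i - a $ i) / l\<rfloor>" for i
    using y unfolding half[of "2 ^ g * _ / l"] by (simp add: D_def mult.assoc)
  then show "y \<in> D g x" by (simp add: D_def)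
qed

lemma D_antimono: "g \<le> h \<Longrightarrow> D h x \<subseteq> D g x"
  using D_Suc_subset lift_Suc_antimono_le[of "\<lambda>g. D g x"] by blast

lemma D_cong_le: "y \<in> D h x \<Longrightarrow> g \<le> h \<Longrightarrow> D g y = D g x"
  using D_antimono D_cong by blast

lemma D_eq_cube:
  "D g x = cube (\<chi> i. a $ i + l / 2 ^ g * \<lfloor>2 ^ g * (x $ i - a $ i) / l\<rfloor>) (l / 2 ^ g)"
proof -
  have "\<lfloor>2 ^ g * (u - a $ i) / l\<rfloor> = k \<longleftrightarrow>
      a $ i + l / 2 ^ g * k \<le> u \<and> u < a $ i + l / 2 ^ g * k + l / 2 ^ g" for u i and k :: int
    using l_pos by (simp add: floor_eq_iff field_simps)
  then show ?thesis by (simp add: D_def cube_def)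
qed

lemma D_lmeasurable [simp]: "D g x \<in> lmeasurable"
  unfolding D_eq_cube using l_pos by (intro cube_lmeasurable) simp

lemma D_sets [simp]: "D g x \<in> sets lebesgue"
  by (rule fmeasurableD) simp

lemma measure_D: "measure lebesgue (D g x) = (l / 2 ^ g) ^ CARD('n)"
  unfolding D_eq_cube using l_pos by (intro measure_cube) simp

lemma measure_D_pos: "measure lebesgue (D g x) > 0"
  unfolding measure_D using l_pos by simp

lemma measure_D_Suc: "measure lebesgue (D g x) = 2 ^ CARD('n) * measure lebesgue (D (Suc g) y)"
  unfolding measure_D by (simp add: power_divide power_mult_distrib)

lemma D_0: "x \<in> cube a l \<Longrightarrow> D 0 x = cube a l"
proof -
  assume x: "x \<in> cube a l"
  have "\<lfloor>(x $ i - a $ i) / l\<rfloor> = 0" for i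
    using x l_pos by (auto simp: cube_def floor_eq_iff field_simps)
  then show ?thesis unfolding D_eq_cube by simp
qed

lemma D_dyadic: "x \<in> cube a l \<Longrightarrow> D g x \<in> dyadic_cubes (cube a l)"
proof (induction g)
  case 0
  then show ?case by (simp add: D_0 dyadic_cubes.root)
next
  case (Suc g)
  let ?c = "\<lambda>g. \<chi> i. a $ i + l / 2 ^ g * \<lfloor>2 ^ g * (x $ i - a $ i) / l\<rfloor>"
  have "cube (?c (Suc g)) (l / 2 ^ g / 2) \<in> dyadic_cubes (cube a l)"
  proof (rule dyadic_cubes.divide)
    show "cube (?c g) (l / 2 ^ g) \<in> dyadic_cubes (cube a l)"
      using Suc unfolding D_eq_cube by simp
    fix i
    \<comment> \<open>The two values of the floor of \<open>2 * u\<close> are the two halves of the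
      parent in direction \<open>i\<close>.\<close>
    define u where "u = 2 ^ g * (x $ i - a $ i) / l"
    have "\<lfloor>2 * u\<rfloor> = 2 * \<lfloor>u\<rfloor> \<or> \<lfloor>2 * u\<rfloor> = 2 * \<lfloor>u\<rfloor> + 1"
      by linarith
    moreover have "2 ^ Suc g * (x $ i - a $ i) / l = 2 * u"
      by (simp add: u_def)
    ultimately show "?c (Suc g) $ i = ?c g $ i \<or> ?c (Suc g) $ i = ?c g $ i + l / 2 ^ g / 2"
      using l_pos by (auto simp: u_def[symmetric] field_simps simp del: power_Suc)
        (auto simp: u_def field_simps)
  qed (use l_pos in simp)
  then show ?case unfolding D_eq_cube by (simp add: mult.commute)
qed

lemma countable_D: "countable {D g x | g x. P g x}"
proof (rule countable_subset)
  \<comment> \<open>A cube is determined by its generation and its integer coordinates; there are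
    countably many of these because \<open>'n\<close> is finite.\<close>
  show "{D g x | g x. P g x} \<subseteq>
      range (\<lambda>(g, k :: 'n \<Rightarrow> int). {y. \<forall>i. \<lfloor>2 ^ g * (y $ i - a $ i) / l\<rfloor> = k i})"
    unfolding D_def by (force simp: image_iff)
qed simp

lemma D_shrinks:
  assumes "open U" "y \<in> U"
  shows "\<exists>g\<ge>h. D g y \<subseteq> U"
proof -
  obtain e where e: "e > 0" "ball y e \<subseteq> U"
    using assms open_contains_ball by blast
  \<comment> \<open>The factor \<open>CARD('n)\<close> comes from bounding the Euclidean norm by the
    sum of the coordinates.\<close>
  have "(\<lambda>g. real CARD('n) * l / 2 ^ g) \<longlonglongrightarrow> 0"
    by (rule LIMSEQ_divide_realpow_zero) simp
  then have "\<forall>\<^sub>F g in sequentially. real CARD('n) * l / 2 ^ g < e"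
    by (rule order_tendstoD) (use e in auto)
  then have "\<forall>\<^sub>F g in sequentially. real CARD('n) * l / 2 ^ g < e \<and> g \<ge> h"
    using eventually_ge_at_top by (rule eventually_conj)
  then obtain g where g: "real CARD('n) * l / 2 ^ g < e" "g \<ge> h"
    using eventually_happens'[OF sequentially_bot] by blast
  have "D g y \<subseteq> ball y e"
  proof
    fix z assume "z \<in> D g y"
    moreover have "y \<in> D g y" by simp
    ultimately have "\<bar>(y - z) $ i\<bar> \<le> l / 2 ^ g" for i
      unfolding D_eq_cube cube_def mem_Collect_eq vec_lambda_beta vector_minus_component
      by (smt (verit, best))
    then have "(\<Sum>i\<in>UNIV. \<bar>(y - z) $ i\<bar>) \<le> (\<Sum>i\<in>(UNIV :: 'n set). l / 2 ^ g)"
      by (rule sum_mono)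
    with norm_le_l1_cart[of "y - z"] g show "z \<in> ball y e"
      by (simp add: dist_norm)
  qed
  then show ?thesis using e g by blast
qed

text \<open>The maximal cubes \<open>D g y\<close> satisfying \<open>P\<close> are pairwise disjoint and cover, so a comparison
  on each cube adds up.\<close>

lemma emeasure_maximal_cubes_le:
  assumes A: "A \<in> sets lebesgue" and B: "B \<in> sets lebesgue"
    and P: "\<And>g y z. P g y \<Longrightarrow> z \<in> D g y \<Longrightarrow> P g z"
    and le: "\<And>g y. y \<in> D h x \<Longrightarrow> h \<le> g \<Longrightarrow> P g y \<Longrightarrow>
      emeasure lebesgue (A \<inter> D g y) \<le> c * emeasure lebesgue (B \<inter> D g y)"
  shows "emeasure lebesgue (A \<inter> {y \<in> D h x. \<exists>g\<ge>h. P g y}) \<le> c * emeasure lebesgue (B \<inter> D h x)"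
proof -
  \<comment> \<open>\<open>R g y\<close> says that \<open>g\<close> is the first generation from
    \<open>h\<close> on at which the cube around \<open>y\<close> satisfies \<open>P\<close>. This
    makes \<open>D g y\<close> maximal, and two such cubes with a common point have the same
    generation.\<close>
  define R where "R g y \<longleftrightarrow> y \<in> D h x \<and> h \<le> g \<and> P g y \<and> (\<forall>g'. h \<le> g' \<and> g' < g \<longrightarrow> \<not> P g' y)" for g y
  define F where "F = {D g y | g y. R g y}"
  have R_D: "R g z" if "R g y" "z \<in> D g y" for g y z
  proof -
    have "\<not> P g' z" if g': "h \<le> g'" "g' < g" for g'
    proof
      assume "P g' z"
      moreover have "y \<in> D g' z"
        using D_cong_le[OF \<open>z \<in> D g y\<close>, of g'] g' by simp
      ultimately show False
        using P g' \<open>R g y\<close> by (auto simp: R_def)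
    qed
    moreover have "z \<in> D h x"
      using that D_antimono[of h g y] D_cong[of y h x] by (auto simp: R_def)
    ultimately show ?thesis
      using that P by (auto simp: R_def)
  qed
  have cF: "countable F" unfolding F_def by (rule countable_D)
  have UF: "\<Union>F = {y \<in> D h x. \<exists>g\<ge>h. P g y}"
  proof (intro equalityI subsetI)
    fix z assume "z \<in> \<Union>F"
    then obtain g y where "R g y" "z \<in> D g y" by (auto simp: F_def)
    then have "R g z" by (rule R_D)
    then show "z \<in> {y \<in> D h x. \<exists>g\<ge>h. P g y}" by (auto simp: R_def)
  next
    fix y assume "y \<in> {y \<in> D h x. \<exists>g\<ge>h. P g y}"
    then obtain g where g: "y \<in> D h x" "h \<le> g \<and> P g y" by blast
    have "R (LEAST g. h \<le> g \<and> P g y) y"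
      unfolding R_def using LeastI[of "\<lambda>g. h \<le> g \<and> P g y", OF g(2)] g(1) not_less_Least by blast
    then show "y \<in> \<Union>F" using D_refl unfolding F_def by blast
  qed
  have "X = Y" if XY: "X \<in> F" "Y \<in> F" "z \<in> X" "z \<in> Y" for X Y z
  proof -
    obtain g y g' y' where "X = D g y" "R g y" "Y = D g' y'" "R g' y'"
      using XY(1,2) unfolding F_def by blast
    moreover from this have "R g z" "R g' z" using XY R_D by blast+
    then have "g = g'" unfolding R_def by (meson linorder_neqE_nat)
    ultimately show ?thesis using XY D_cong by metis
  qed
  then have dis: "disjoint_family_on (\<lambda>X. C \<inter> X) F" for C
    unfolding disjoint_family_on_def by blast
  have setsF: "X \<in> sets lebesgue" if "X \<in> F" for X
    using that by (auto simp: F_def)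
  \<comment> \<open>Written as an integral over counting measure, the sum over the cubes lets
    \<open>c\<close> be pulled out directly.\<close>
  have split: "emeasure lebesgue (C \<inter> \<Union>F) = (\<integral>\<^sup>+X. emeasure lebesgue (C \<inter> X) \<partial>count_space F)"
    if "C \<in> sets lebesgue" for C
    unfolding Int_Union using setsF that by (intro emeasure_UN_countable cF dis) auto
  have "emeasure lebesgue (A \<inter> \<Union>F) \<le> (\<integral>\<^sup>+X. c * emeasure lebesgue (B \<inter> X) \<partial>count_space F)"
    unfolding split[OF A] by (rule nn_integral_mono) (auto simp: F_def R_def intro: le)
  also have "\<dots> = c * emeasure lebesgue (B \<inter> \<Union>F)"
    unfolding split[OF B] by (rule nn_integral_cmult) simp
  also have "\<dots> \<le> c * emeasure lebesgue (B \<inter> D h x)"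
    by (intro mult_left_mono emeasure_mono) (use B in \<open>auto simp: UF\<close>)
  finally show ?thesis unfolding UF .
qed

text \<open>A substitute for the density theorem. Cover \<open>A\<close> by an open \<open>U\<close>
  with excess below \<open>e\<close>. The maximal cubes inside \<open>U\<close> cover
  \<open>A\<close>, and \<open>A\<close> fills at most half of each, so
  \<open>|A| \<le> (|A| + e) / 2\<close>, that is \<open>|A| \<le> e\<close>.\<close>

lemma null_if_thin_in_cubes:
  assumes A: "A \<in> sets lebesgue" and sub: "A \<subseteq> D h x"
    and thin: "\<And>g y. y \<in> D h x \<Longrightarrow> h \<le> g \<Longrightarrow>
      measure lebesgue (A \<inter> D g y) \<le> measure lebesgue (D g y) / 2"
  shows "A \<in> null_sets lebesgue"
proof -
  have Am: "A \<in> lmeasurable"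
    using fmeasurableI2[OF D_lmeasurable sub A] .
  have "measure lebesgue A \<le> e" if "e > 0" for e
  proof -
    obtain U where U: "open U" "A \<subseteq> U" "U - A \<in> lmeasurable" "emeasure lebesgue (U - A) < ennreal e"
      using sets_lebesgue_outer_open[OF A \<open>e > 0\<close>] by blast
    have "emeasure lebesgue (A \<inter> {y \<in> D h x. \<exists>g\<ge>h. D g y \<subseteq> U})
        \<le> ennreal (1 / 2) * emeasure lebesgue (U \<inter> D h x)"
    proof (rule emeasure_maximal_cubes_le)
      fix g y assume *: "y \<in> D h x" "h \<le> g" "D g y \<subseteq> U"
      have "A \<inter> D g y \<in> lmeasurable" using Am by (intro fmeasurable_Int_fmeasurable) auto
      moreover have "U \<inter> D g y = D g y" using * by auto
      ultimately show "emeasure lebesgue (A \<inter> D g y) \<le> ennreal (1 / 2) * emeasure lebesgue (U \<inter> D g y)"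
        using thin[OF *(1,2)]
        by (simp add: emeasure_eq_measure2 ennreal_mult[symmetric] del: ennreal_half)
    qed (use A U D_cong in auto)
    moreover have "A \<inter> {y \<in> D h x. \<exists>g\<ge>h. D g y \<subseteq> U} = A"
      using sub U(1,2) D_shrinks by blast
    moreover have "emeasure lebesgue (U \<inter> D h x) \<le> emeasure lebesgue (A \<union> (U - A))"
      by (rule emeasure_mono) (use A U in auto)
    moreover have "measure lebesgue (A \<union> (U - A)) \<le> measure lebesgue A + measure lebesgue (U - A)"
      using measure_Un_le[of A lebesgue "U - A"] A U by auto
    moreover have "measure lebesgue (U - A) < e"
      using U by (simp add: emeasure_eq_measure2 ennreal_less_iff)
    moreover have "A \<union> (U - A) \<in> lmeasurable" using Am U by blast
    ultimately have "emeasure lebesgue A \<le> ennreal (1 / 2) * emeasure lebesgue (A \<union> (U - A))"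
      by (metis (no_types, lifting) mult_left_mono order_trans zero_le)
    then have "measure lebesgue A \<le> 1 / 2 * measure lebesgue (A \<union> (U - A))"
      using Am \<open>A \<union> (U - A) \<in> lmeasurable\<close>
      by (simp add: emeasure_eq_measure2 ennreal_mult[symmetric] del: ennreal_half Un_Diff_cancel)
    then show ?thesis
      using \<open>measure lebesgue (A \<union> (U - A)) \<le> _\<close> \<open>measure lebesgue (U - A) < e\<close> by linarith
  qed
  then have "measure lebesgue A \<le> 0"
    by (rule field_le_epsilon[of _ 0, simplified])
  then show ?thesis
    using Am by (simp add: measure_le_0_iff emeasure_eq_measure2 null_setsI A)
qed

end

subsection \<open>The stopping cubes\<close>

lemma sum_le_infsum_ennreal:
  fixes g :: "'b \<Rightarrow> ennreal"
  assumes "finite F" "F \<subseteq> A"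
  shows "sum g F \<le> infsum g A"
proof -
  have "infsum g F \<le> infsum g A"
    by (rule infsum_mono_neutral) (use assms in \<open>auto intro: nonneg_summable_on_complete\<close>)
  then show ?thesis using assms by simp
qed

lemma ennreal_abs_diff_triangle: "ennreal \<bar>u - w\<bar> \<le> ennreal \<bar>u - v\<bar> + ennreal \<bar>v - w\<bar>"
  by (simp add: ennreal_plus[symmetric] ennreal_leI del: ennreal_plus)

locale local_osc_decomposition = dyadic_grid a l for a :: "real ^ 'n" and l :: real +
  fixes f :: "real ^ 'n \<Rightarrow> real"
  assumes f: "f \<in> borel_measurable lebesgue"
begin

abbreviation med :: "nat \<Rightarrow> real ^ 'n \<Rightarrow> real" where
  "med g x \<equiv> median f (D g x)"

abbreviation osc :: "nat \<Rightarrow> real ^ 'n \<Rightarrow> ennreal" where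
  "osc g x \<equiv> local_osc (1 / 2 ^ (CARD('n) + 2)) f (D g x)"

abbreviation cubes_union :: "nat \<Rightarrow> real ^ 'n \<Rightarrow> (nat \<Rightarrow> real ^ 'n \<Rightarrow> bool) \<Rightarrow> (real ^ 'n) set" where
  "cubes_union h x P \<equiv> {y \<in> D h x. \<exists>g\<ge>h. P g y}"

text \<open>The set \<open>E\<close> of the overview. Comparing in \<open>ennreal\<close> makes it
  empty when the oscillation is infinite.\<close>

definition dev :: "nat \<Rightarrow> real ^ 'n \<Rightarrow> (real ^ 'n) set" where
  "dev h x = {y \<in> D h x. 2 * osc h x < ennreal \<bar>f y - med h x\<bar>}"

text \<open>The condition is on the children of \<open>D g y\<close> rather than on \<open>D g y\<close> itself, so that it is the
  stopping cube whose median is still controlled by its unstopped parent.\<close>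

definition stop :: "nat \<Rightarrow> real ^ 'n \<Rightarrow> nat \<Rightarrow> real ^ 'n \<Rightarrow> bool" where
  "stop h x g y \<longleftrightarrow> (\<exists>z\<in>D g y. 2 * osc h x < ennreal \<bar>med (Suc g) z - med h x\<bar>)"

lemma stop_cong: "stop h x g y \<Longrightarrow> z \<in> D g y \<Longrightarrow> stop h x g z"
  using D_cong[of z g y] by (simp add: stop_def)

lemma stop_base_cong: "z \<in> D h x \<Longrightarrow> stop h z = stop h x"
  by (intro ext) (simp add: stop_def D_cong)

lemma dev_lmeasurable: "dev h x \<in> lmeasurable"
proof -
  have "{t :: real. 2 * osc h x < ennreal \<bar>t - med h x\<bar>} \<in> sets borel" by measurable
  from lmeasurable_Collect_in[OF f D_lmeasurable this]
  show ?thesis by (simp add: dev_def)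
qed

lemma measure_dev: "measure lebesgue (dev h x) \<le> 1 / 2 ^ (CARD('n) + 2) * measure lebesgue (D h x)"
  unfolding dev_def
proof (rule measure_dev_le_osc[OF f D_lmeasurable measure_D_pos])
  have "(1 :: real) * 2 \<le> 2 ^ CARD('n) * 4" by (rule mult_mono) auto
  then show "1 / 2 ^ (CARD('n) + 2) \<le> (1 / 2 :: real)" by (simp add: field_simps)
qed simp

text \<open>On at least half of the witnessing child, \<open>f\<close> is at least as far from
  \<open>med h x\<close> as the median of the child, on the same side; this half lies in
  \<open>dev h x\<close>. The child is a \<open>2 ^ CARD('n)\<close>-th part of
  \<open>D g y\<close>, whence the constant.\<close>

lemma measure_stop_le:
  assumes "y \<in> D h x" "h \<le> g" "stop h x g y"
  shows "measure lebesgue (D g y) \<le> 2 ^ (CARD('n) + 1) * measure lebesgue (dev h x \<inter> D g y)"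
proof -
  obtain z where z: "z \<in> D g y" "2 * osc h x < ennreal \<bar>med (Suc g) z - med h x\<bar>"
    using assms by (auto simp: stop_def)
  let ?Q = "D (Suc g) z"
  have sub: "?Q \<subseteq> D g y" "D g y \<subseteq> D h x"
    using D_Suc_subset[of g z] D_cong[OF z(1)] D_antimono[OF assms(2), of y] D_cong[OF assms(1)] by auto
  have I: "dev h x \<inter> D g y \<in> lmeasurable"
    using dev_lmeasurable by (intro fmeasurable_Int_fmeasurable) auto
  have dev_if: "v \<in> dev h x \<inter> D g y"
    if "v \<in> ?Q" "\<bar>med (Suc g) z - med h x\<bar> \<le> \<bar>f v - med h x\<bar>" for v
    using that sub less_le_trans[OF z(2) ennreal_leI[OF that(2)]] by (auto simp: dev_def)
  have "measure lebesgue ?Q / 2 \<le> measure lebesgue (dev h x \<inter> D g y)"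
  proof (cases "med h x \<le> med (Suc g) z")
    case True
    have "{v \<in> ?Q. f v \<ge> med (Suc g) z} \<subseteq> dev h x \<inter> D g y"
      using dev_if True by fastforce
    then have "measure lebesgue {v \<in> ?Q. f v \<ge> med (Suc g) z} \<le> measure lebesgue (dev h x \<inter> D g y)"
      using I lmeasurable_Collect_in[OF f D_lmeasurable, of "{med (Suc g) z..}" "Suc g" z]
      by (intro measure_mono_fmeasurable fmeasurableD) auto
    with measure_median_ge[OF f D_lmeasurable measure_D_pos] show ?thesis
      by (rule order_trans)
  next
    case False
    have "{v \<in> ?Q. f v \<le> med (Suc g) z} \<subseteq> dev h x \<inter> D g y"
      using dev_if False by fastforce
    then have "measure lebesgue {v \<in> ?Q. f v \<le> med (Suc g) z} \<le> measure lebesgue (dev h x \<inter> D g y)"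
      using I lmeasurable_Collect_in[OF f D_lmeasurable, of "{..med (Suc g) z}" "Suc g" z]
      by (intro measure_mono_fmeasurable fmeasurableD) auto
    with measure_median_le[OF f D_lmeasurable measure_D_pos] show ?thesis
      by (rule order_trans)
  qed
  then show ?thesis using measure_D_Suc[of g y z] by simp
qed

text \<open>Summed over the maximal stopped cubes, the factor \<open>2 ^ (CARD('n) + 1)\<close>
  meets the bound \<open>1 / 2 ^ (CARD('n) + 2)\<close> on the relative size of
  \<open>dev h x\<close>. The product is \<open>1 / 2\<close>, which explains the parameter of the
  oscillation.\<close>

lemma emeasure_stopped_le:
  "emeasure lebesgue (cubes_union h x (stop h x)) \<le> ennreal (1 / 2) * emeasure lebesgue (D h x)"
proof -
  let ?c = "2 ^ (CARD('n) + 1) :: real"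
  have "emeasure lebesgue (UNIV \<inter> cubes_union h x (stop h x))
      \<le> ennreal ?c * emeasure lebesgue (dev h x \<inter> D h x)"
  proof (rule emeasure_maximal_cubes_le)
    fix g y assume *: "y \<in> D h x" "h \<le> g" "stop h x g y"
    have "dev h x \<inter> D g y \<in> lmeasurable"
      using dev_lmeasurable by (intro fmeasurable_Int_fmeasurable) auto
    then show "emeasure lebesgue (UNIV \<inter> D g y) \<le> ennreal ?c * emeasure lebesgue (dev h x \<inter> D g y)"
      using measure_stop_le[OF *]
      by (simp add: emeasure_eq_measure2 ennreal_mult[symmetric] del: power_Suc)
  qed (use dev_lmeasurable in \<open>auto intro: stop_cong\<close>)
  also have "dev h x \<inter> D h x = dev h x" by (auto simp: dev_def)
  also have "ennreal ?c * emeasure lebesgue (dev h x) = ennreal (?c * measure lebesgue (dev h x))"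
    using dev_lmeasurable[of h x] by (simp add: emeasure_eq_measure2 ennreal_mult)
  also have "\<dots> \<le> ennreal (1 / 2 * measure lebesgue (D h x))"
    using measure_dev[of h x] by (intro ennreal_leI) (simp add: field_simps)
  also have "\<dots> = ennreal (1 / 2) * emeasure lebesgue (D h x)"
    by (simp add: emeasure_eq_measure2 ennreal_mult[symmetric] del: ennreal_half)
  finally show ?thesis unfolding Int_UNIV_left .
qed

lemma cubes_union_sets:
  assumes P: "\<And>g y z. P g y \<Longrightarrow> z \<in> D g y \<Longrightarrow> P g z"
  shows "cubes_union h x P \<in> sets lebesgue"
proof -
  have "cubes_union h x P = \<Union>{D g y | g y. y \<in> D h x \<and> h \<le> g \<and> P g y}" (is "?L = \<Union>?R")
  proof (intro equalityI subsetI)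
    fix y assume "y \<in> ?L"
    then show "y \<in> \<Union>?R" using D_refl by blast
  next
    fix z assume "z \<in> \<Union>?R"
    then obtain g y where "y \<in> D h x" "h \<le> g" "P g y" "z \<in> D g y" by blast
    then show "z \<in> ?L" using P D_antimono D_cong by blast
  qed
  moreover have "\<Union>?R \<in> sets lebesgue"
    by (rule sets.countable_Union) (use countable_D in auto)
  ultimately show ?thesis by simp
qed

lemma med_diff_le:
  assumes "h \<le> g" "\<And>g'. h \<le> g' \<Longrightarrow> g' < g \<Longrightarrow> \<not> stop h x g' z" "z \<in> D h x"
  shows "ennreal \<bar>med g z - med h x\<bar> \<le> 2 * osc h x"
proof (cases "g = h")
  case True
  then show ?thesis using D_cong[OF assms(3)] by simp
next
  case False
  \<comment> \<open>For \<open>g > h\<close> the parent, of generation \<open>g - 1\<close>, is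
    unstopped, and \<open>D g z\<close> is one of its children. The bound thus includes the first
    stopped cube.\<close>
  with assms(1) obtain g' where "g = Suc g'" "h \<le> g'"
    by (metis le_eq_less_or_eq less_eq_Suc_le Suc_le_D Suc_le_mono)
  with assms(2)[of g'] show ?thesis
    by (auto simp: stop_def not_less dest: bspec[OF _ D_refl])
qed

text \<open>A cube meeting the set contains an unstopped point, so its median is within
  \<open>2 * w\<close> of \<open>med h x\<close>. Points deviating by more than \<open>2 * w\<close>
  in the direction \<open>s\<close> are then strictly beyond that median and fill at most half of
  the cube. Both directions together could fill more, so they are treated separately.\<close>

lemma null_unstopped_side:
  assumes w: "osc h x = ennreal w" "w \<ge> 0" and s: "s = 1 \<or> s = (- 1 :: real)"
  shows "{y \<in> D h x. (\<forall>g\<ge>h. \<not> stop h x g y) \<and> s * (f y - med h x) > 2 * w} \<in> null_sets lebesgue"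
    (is "?A \<in> _")
proof (rule null_if_thin_in_cubes[where h = h and x = x])
  have "(\<lambda>y. s * (f y - med h x)) \<in> borel_measurable lebesgue" using f by simp
  from lmeasurable_Collect_in[OF this D_lmeasurable, of "{2 * w<..}" h x]
  have "{y \<in> D h x. s * (f y - med h x) > 2 * w} - cubes_union h x (stop h x) \<in> sets lebesgue"
    by (intro sets.Diff[OF fmeasurableD cubes_union_sets[OF stop_cong]]) simp_all
  also have "{y \<in> D h x. s * (f y - med h x) > 2 * w} - cubes_union h x (stop h x) = ?A" by auto
  finally show A: "?A \<in> sets lebesgue" .
  show "?A \<subseteq> D h x" by blast
  fix g y assume y: "y \<in> D h x" "h \<le> g"
  show "measure lebesgue (?A \<inter> D g y) \<le> measure lebesgue (D g y) / 2"
  proof (cases "?A \<inter> D g y = {}")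
    case False
    then obtain z where z: "z \<in> ?A" "z \<in> D g y" by blast
    have "ennreal \<bar>med g z - med h x\<bar> \<le> ennreal (2 * w)"
      using med_diff_le[OF y(2), of x z] z(1) w by (simp add: ennreal_mult')
    then have close: "\<bar>med g y - med h x\<bar> \<le> 2 * w"
      using w D_cong[OF z(2)] by simp
    have lt: "{v \<in> D g y. f v < med g y} \<in> lmeasurable" and gt: "{v \<in> D g y. f v > med g y} \<in> lmeasurable"
      using lmeasurable_Collect_in[OF f D_lmeasurable, of "{..<med g y}" g y]
        lmeasurable_Collect_in[OF f D_lmeasurable, of "{med g y<..}" g y] by simp_all
    have med: "measure lebesgue {v \<in> D g y. f v > med g y} \<le> measure lebesgue (D g y) / 2"
      "measure lebesgue {v \<in> D g y. f v < med g y} \<le> measure lebesgue (D g y) / 2"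
      using is_median_median[OF f D_lmeasurable measure_D_pos, of g y] by (auto simp: is_median_def)
    from s show ?thesis
    proof
      assume s: "s = 1"
      have "measure lebesgue (?A \<inter> D g y) \<le> measure lebesgue {v \<in> D g y. f v > med g y}"
      proof (rule measure_mono_fmeasurable[OF _ sets.Int[OF A D_sets] gt])
        show "?A \<inter> D g y \<subseteq> {v \<in> D g y. f v > med g y}" using s close by auto
      qed
      then show ?thesis using med(1) by (rule order_trans)
    next
      assume s: "s = - 1"
      have "measure lebesgue (?A \<inter> D g y) \<le> measure lebesgue {v \<in> D g y. f v < med g y}"
      proof (rule measure_mono_fmeasurable[OF _ sets.Int[OF A D_sets] lt])
        show "?A \<inter> D g y \<subseteq> {v \<in> D g y. f v < med g y}" using s close by auto
      qed
      then show ?thesis using med(2) by (rule order_trans)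
    qed
  qed simp
qed

lemma null_unstopped: "dev h x - cubes_union h x (stop h x) \<in> null_sets lebesgue"
proof (cases "osc h x")
  case top
  then have "dev h x = {}" by (simp add: dev_def ennreal_mult_top)
  then show ?thesis by simp
next
  case (real w)
  let ?A = "\<lambda>s. {y \<in> D h x. (\<forall>g\<ge>h. \<not> stop h x g y) \<and> s * (f y - med h x) > 2 * w}"
  have "?A 1 \<union> ?A (- 1) \<in> null_sets lebesgue"
    by (intro null_sets.Un null_unstopped_side real) auto
  moreover have "2 * osc h x = ennreal (2 * w)"
    using real by (simp add: ennreal_mult')
  then have "dev h x - cubes_union h x (stop h x) = ?A 1 \<union> ?A (- 1)"
    using real by (auto simp: dev_def ennreal_less_iff)
  ultimately show ?thesis by simp
qed

section \<open>Iterated stopping: levels and their measure\<close>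

text \<open>The generation of the cube of level \<open>k\<close> containing a point, if there is one.\<close>

primrec gen :: "nat \<Rightarrow> real ^ 'n \<Rightarrow> nat option" where
  "gen 0 x = Some 0"
| "gen (Suc k) x = (case gen k x of None \<Rightarrow> None
    | Some h \<Rightarrow> if \<exists>g\<ge>h. stop h x g x then Some (LEAST g. h \<le> g \<and> stop h x g x) else None)"

text \<open>The case \<open>g = h\<close> is not excluded by the recursion but cannot occur: all of
  \<open>D h x\<close> would then be stopped, against \<open>emeasure_stopped_le\<close>.\<close>

lemma gen_SucD:
  assumes "gen (Suc k) x = Some g"
  obtains h where "gen k x = Some h" "h \<le> g" "stop h x g x"
    "\<And>g'. h \<le> g' \<Longrightarrow> g' < g \<Longrightarrow> \<not> stop h x g' x"
proof -
  from assms obtain h where h: "gen k x = Some h" "\<exists>g\<ge>h. stop h x g x"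
    and g: "g = (LEAST g. h \<le> g \<and> stop h x g x)"
    by (auto split: option.splits if_splits)
  from LeastI_ex[OF h(2)] have "h \<le> g \<and> stop h x g x" unfolding g .
  moreover have "\<not> stop h x g' x" if "h \<le> g'" "g' < g" for g'
    using not_less_Least[of g' "\<lambda>g. h \<le> g \<and> stop h x g x"] that unfolding g by blast
  ultimately show thesis using that h(1) by blast
qed

lemma gen_SucI:
  assumes "gen k x = Some h" "h \<le> g" "stop h x g x"
    "\<And>g'. h \<le> g' \<Longrightarrow> g' < g \<Longrightarrow> \<not> stop h x g' x"
  shows "gen (Suc k) x = Some g"
proof -
  have "(LEAST g. h \<le> g \<and> stop h x g x) = g"
    by (rule Least_equality) (use assms not_less in blast)+
  then show ?thesis using assms by auto
qed

text \<open>The stopping tests up to generation \<open>h\<close> look only at cubes containing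
  \<open>D h x\<close>, and these are the same for all its points.\<close>

lemma gen_cong: "gen k x = Some h \<Longrightarrow> y \<in> D h x \<Longrightarrow> gen k y = Some h"
proof (induction k arbitrary: h)
  case (Suc k)
  from Suc.prems(1) obtain h' where h': "gen k x = Some h'" "h' \<le> h" "stop h' x h x"
    "\<And>g'. h' \<le> g' \<Longrightarrow> g' < h \<Longrightarrow> \<not> stop h' x g' x" by (rule gen_SucD) blast
  have y: "y \<in> D h' x" using Suc.prems(2) h'(2) D_antimono by blast
  have stop_eq: "stop h' y g y \<longleftrightarrow> stop h' x g x" if "g \<le> h" for g
    unfolding stop_base_cong[OF y] using D_cong_le[OF Suc.prems(2) that] by (simp add: stop_def)
  show ?case
    by (rule gen_SucI[of _ _ h']) (use h' Suc.IH y stop_eq in auto)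
qed simp

lemma gen_antimono: "i \<le> k \<Longrightarrow> gen k x \<noteq> None \<Longrightarrow> gen i x \<noteq> None"
  by (induction k) (auto simp: le_Suc_eq split: option.splits)

definition level_cubes :: "nat \<Rightarrow> (real ^ 'n) set set" where
  "level_cubes k = {D h x | h x. x \<in> cube a l \<and> gen k x = Some h}"

definition level_set :: "nat \<Rightarrow> (real ^ 'n) set" where
  "level_set k = {x \<in> cube a l. gen k x \<noteq> None}"

lemma countable_level_cubes: "countable (level_cubes k)"
  unfolding level_cubes_def by (rule countable_D)

lemma D_subset_cube: "x \<in> cube a l \<Longrightarrow> D h x \<subseteq> cube a l"
  using D_antimono[of 0 h x] D_0 by simp

lemma Union_level_cubes: "\<Union>(level_cubes k) = level_set k"
proof (intro equalityI subsetI)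
  fix z assume "z \<in> \<Union>(level_cubes k)"
  then obtain h x where hx: "x \<in> cube a l" "gen k x = Some h" "z \<in> D h x"
    unfolding level_cubes_def by blast
  then have "z \<in> cube a l" using D_subset_cube by blast
  with gen_cong[OF hx(2,3)] show "z \<in> level_set k"
    by (simp add: level_set_def)
next
  fix z assume "z \<in> level_set k"
  then obtain h where "z \<in> cube a l" "gen k z = Some h"
    unfolding level_set_def by blast
  then have "D h z \<in> level_cubes k"
    unfolding level_cubes_def by blast
  then show "z \<in> \<Union>(level_cubes k)"
    using D_refl by blast
qed

lemma level_cubes_disjoint:
  assumes "X \<in> level_cubes k" "Y \<in> level_cubes k" "z \<in> X" "z \<in> Y"
  shows "X = Y"
proof -
  obtain h x h' y where X: "X = D h x" "gen k x = Some h" and Y: "Y = D h' y" "gen k y = Some h'"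
    using assms(1,2) unfolding level_cubes_def by blast
  have "gen k z = Some h" "gen k z = Some h'"
    by (rule gen_cong[OF X(2)], use X assms in blast) (rule gen_cong[OF Y(2)], use Y assms in blast)
  then show ?thesis using X Y assms(3,4) D_cong[of z h x] D_cong[of z h' y] by simp
qed

lemma level_set_sets: "level_set k \<in> sets lebesgue"
  unfolding Union_level_cubes[symmetric]
  by (rule sets.countable_Union) (use countable_level_cubes in \<open>auto simp: level_cubes_def\<close>)

lemma level_set_antimono: "level_set (Suc k) \<subseteq> level_set k"
  using gen_antimono[of k "Suc k"] by (auto simp: level_set_def simp del: gen.simps)

text \<open>Localizes the next level: all points of a level cube share the generation
  \<open>h\<close> and the stopping condition, so the bound for one stopping step applies inside
  each level cube.\<close>

lemma level_set_Int_D: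
  assumes "x \<in> cube a l" "gen k x = Some h"
  shows "level_set (Suc k) \<inter> D h x = cubes_union h x (stop h x)"
proof -
  have "gen (Suc k) y \<noteq> None \<longleftrightarrow> (\<exists>g\<ge>h. stop h x g y)" if "y \<in> D h x" for y
    using gen_cong[OF assms(2) that] stop_base_cong[OF that] by simp
  moreover have "y \<in> cube a l" if "y \<in> D h x" for y
    using D_subset_cube[OF assms(1)] that by blast
  ultimately show ?thesis
    unfolding level_set_def by blast
qed

lemma emeasure_level_set_Int_D:
  assumes "x \<in> cube a l" "gen k x = Some h"
  shows "emeasure lebesgue (level_set (Suc k) \<inter> D h x) \<le> ennreal (1 / 2) * emeasure lebesgue (D h x)"
  unfolding level_set_Int_D[OF assms] by (rule emeasure_stopped_le)

lemma emeasure_level_set: "emeasure lebesgue (level_set k) \<le> ennreal (1 / 2) ^ k * emeasure lebesgue (cube a l)"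
proof (induction k)
  case 0
  have "level_set 0 = cube a l" by (simp add: level_set_def)
  then show ?case by simp
next
  case (Suc k)
  have a: "a \<in> cube a l" using l_pos by (simp add: cube_def)
  \<comment> \<open>Taking \<open>gen k y = Some g\<close> as the predicate makes the maximal cubes
    exactly those of level \<open>k\<close>, so the halving inside each of them adds up.\<close>
  have "emeasure lebesgue (level_set (Suc k) \<inter> cubes_union 0 a (\<lambda>g y. gen k y = Some g))
      \<le> ennreal (1 / 2) * emeasure lebesgue (level_set k \<inter> D 0 a)"
  proof (rule emeasure_maximal_cubes_le)
    fix g y assume y: "y \<in> D 0 a" "gen k y = Some g"
    then have y': "y \<in> cube a l" using D_0[OF a] by simp
    then have "D g y \<in> level_cubes k" using y unfolding level_cubes_def by blast
    then have "level_set k \<inter> D g y = D g y"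
      using Union_level_cubes by blast
    then show "emeasure lebesgue (level_set (Suc k) \<inter> D g y)
        \<le> ennreal (1 / 2) * emeasure lebesgue (level_set k \<inter> D g y)"
      using emeasure_level_set_Int_D[OF y' y(2)] by simp
  qed (rule level_set_sets | erule gen_cong, assumption)+
  moreover have "level_set (Suc k) \<inter> cubes_union 0 a (\<lambda>g y. gen k y = Some g) = level_set (Suc k)"
    using level_set_antimono[of k] D_0[OF a] by (auto simp: level_set_def simp del: gen.simps)
  moreover have "level_set k \<inter> D 0 a = level_set k"
    using D_0[OF a] by (auto simp: level_set_def)
  ultimately have "emeasure lebesgue (level_set (Suc k)) \<le> ennreal (1 / 2) * emeasure lebesgue (level_set k)"
    by simp
  also have "\<dots> \<le> ennreal (1 / 2) * (ennreal (1 / 2) ^ k * emeasure lebesgue (cube a l))"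
    by (intro mult_left_mono Suc.IH) simp
  finally show ?case by (simp add: mult.assoc del: ennreal_half)
qed

text \<open>The levels shrink geometrically; hence almost every point lies in only finitely many of
  the chosen cubes.\<close>

lemma null_all_levels: "(\<Inter>k. level_set k) \<in> null_sets lebesgue"
proof -
  have L: "cube a l \<in> lmeasurable" using l_pos by (rule cube_lmeasurable)
  have S: "(\<Inter>k. level_set k) \<in> sets lebesgue"
    using level_set_sets by blast
  have I: "(\<Inter>k. level_set k) \<in> lmeasurable"
    by (rule fmeasurableI2[OF L _ S]) (auto simp: level_set_def)
  have "measure lebesgue (\<Inter>k. level_set k) \<le> (1 / 2) ^ k * measure lebesgue (cube a l)" for k
  proof -
    have "emeasure lebesgue (\<Inter>k. level_set k) \<le> emeasure lebesgue (level_set k)"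
      by (rule emeasure_mono) (use level_set_sets in auto)
    also note emeasure_level_set[of k]
    finally show ?thesis
      using I L by (simp add: emeasure_eq_measure2 ennreal_power ennreal_mult[symmetric] del: ennreal_half)
  qed
  moreover have "(\<lambda>k. (1 / 2) ^ k * measure lebesgue (cube a l)) \<longlonglongrightarrow> 0 * measure lebesgue (cube a l)"
    by (intro tendsto_mult LIMSEQ_realpow_zero tendsto_const) auto
  ultimately have "measure lebesgue (\<Inter>k. level_set k) \<le> 0"
    by (metis (no_types, lifting) LIMSEQ_le_const mult_zero_left)
  then show ?thesis
    using I S by (simp add: measure_le_0_iff emeasure_eq_measure2 null_setsI)
qed

section \<open>The pointwise bound along the chain of cubes\<close>

text \<open>Passing to the next cube of the chain moves the median by at most twice the oscillation
  on the old cube, because the new cube is the first one stopped.\<close>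

lemma telescope:
  "gen k x = Some h \<Longrightarrow>
    ennreal \<bar>f x - med 0 x\<bar> \<le> ennreal \<bar>f x - med h x\<bar> + 2 * (\<Sum>i<k. osc (the (gen i x)) x)"
proof (induction k arbitrary: h)
  case (Suc k)
  from Suc.prems obtain h' where h': "gen k x = Some h'" "h' \<le> h" "stop h' x h x"
    "\<And>g'. h' \<le> g' \<Longrightarrow> g' < h \<Longrightarrow> \<not> stop h' x g' x" by (rule gen_SucD) blast
  let ?S = "2 * (\<Sum>i<k. osc (the (gen i x)) x)"
  have "ennreal \<bar>f x - med 0 x\<bar> \<le> ennreal \<bar>f x - med h' x\<bar> + ?S"
    by (rule Suc.IH[OF h'(1)])
  also have "\<dots> \<le> (ennreal \<bar>f x - med h x\<bar> + ennreal \<bar>med h x - med h' x\<bar>) + ?S"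
    by (intro add_right_mono ennreal_abs_diff_triangle)
  also have "\<dots> \<le> (ennreal \<bar>f x - med h x\<bar> + 2 * osc h' x) + ?S"
    by (intro add_right_mono add_left_mono med_diff_le h') simp_all
  also have "\<dots> = ennreal \<bar>f x - med h x\<bar> + 2 * (\<Sum>i<Suc k. osc (the (gen i x)) x)"
    using h'(1) by (simp add: distrib_left ac_simps)
  finally show ?case .
qed simp

lemma finite_levels_bound:
  assumes x: "x \<in> cube a l" and fin: "x \<notin> (\<Inter>k. level_set k)"
    and good: "\<And>h. x \<notin> dev h x - cubes_union h x (stop h x)"
  shows "\<exists>K. (\<forall>i<K. gen i x \<noteq> None) \<and>
    ennreal \<bar>f x - median f (cube a l)\<bar> \<le> 2 * (\<Sum>i<K. osc (the (gen i x)) x)"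
proof -
  define K where "K = (LEAST k. gen k x = None)"
  have "\<exists>k. gen k x = None" using fin x by (auto simp: level_set_def)
  then have K: "gen K x = None" unfolding K_def by (rule LeastI_ex)
  have lt: "gen i x \<noteq> None" if "i < K" for i
    using that not_less_Least unfolding K_def by blast
  \<comment> \<open>\<open>K\<close> is positive because level 0 always exists. The cube of level
    \<open>K - 1\<close> is the last one around \<open>x\<close>, and the final deviation from its
    median supplies the last term of the sum.\<close>
  from K obtain k where k: "K = Suc k" by (cases K) auto
  then obtain h where h: "gen k x = Some h" using lt[of k] by auto
  have "\<not> (\<exists>g\<ge>h. stop h x g x)" using K k h by (auto split: if_splits)
  then have "x \<notin> dev h x" using good[of h] by auto
  then have le: "ennreal \<bar>f x - med h x\<bar> \<le> 2 * osc h x" by (simp add: dev_def not_less)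
  have "ennreal \<bar>f x - med 0 x\<bar> \<le> ennreal \<bar>f x - med h x\<bar> + 2 * (\<Sum>i<k. osc (the (gen i x)) x)"
    by (rule telescope[OF h])
  also have "\<dots> \<le> 2 * osc h x + 2 * (\<Sum>i<k. osc (the (gen i x)) x)"
    by (intro add_right_mono le)
  also have "\<dots> = 2 * (\<Sum>i<K. osc (the (gen i x)) x)"
    using h by (simp add: k distrib_left ac_simps)
  finally have "ennreal \<bar>f x - median f (cube a l)\<bar> \<le> 2 * (\<Sum>i<K. osc (the (gen i x)) x)"
    unfolding D_0[OF x] .
  with lt show ?thesis by blast
qed

lemma AE_finite_levels:
  "AE x in lebesgue. x \<notin> (\<Inter>k. level_set k) \<and> (\<forall>h. x \<notin> dev h x - cubes_union h x (stop h x))"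
proof -
  define N where "N h x = dev h x - cubes_union h x (stop h x)" for h x
  have N_cong: "N h y = N h x" if "D h y = D h x" for h x y
    using that stop_base_cong[of y h x] D_refl[of y h] by (simp add: N_def dev_def)
  \<comment> \<open>The exceptional set \<open>N h x\<close> varies with \<open>x\<close>, but only
    through the cube \<open>D h x\<close>; one representative for each of the countably many cubes
    suffices.\<close>
  have "AE x in lebesgue. x \<notin> N h x" for h
  proof -
    have "countable (range (D h))"
      by (rule countable_subset[OF _ countable_D[of "\<lambda>_ _. True"]]) auto
    then obtain C where C: "countable C" "range (D h) = D h ` C"
      using countable_subset_image[of "range (D h)" "D h" UNIV] by blast
    have "(\<Union>c\<in>C. N h c) \<in> null_sets lebesgue"
      by (rule null_sets_UN'[OF C(1)]) (simp add: N_def null_unstopped)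
    moreover have "x \<in> (\<Union>c\<in>C. N h c)" if "x \<in> N h x" for x
    proof -
      obtain c where "c \<in> C" "D h x = D h c" using C(2) by blast
      then show ?thesis using that N_cong by blast
    qed
    ultimately show ?thesis by (intro AE_I'[where N = "\<Union>c\<in>C. N h c"]) auto
  qed
  then have "AE x in lebesgue. \<forall>h. x \<notin> N h x"
    by (simp add: AE_all_countable)
  moreover have "AE x in lebesgue. x \<notin> (\<Inter>k. level_set k)"
    by (rule AE_not_in[OF null_all_levels])
  ultimately show ?thesis unfolding N_def by eventually_elim blast
qed

section \<open>Indexing the levels as a sparse family\<close>

text \<open>Using the image of \<open>to_nat_on\<close> as index set treats empty, finite and
  infinite levels alike, with each cube listed once.\<close>

definition level_index :: "nat \<Rightarrow> nat set" where
  "level_index k = to_nat_on (level_cubes k) ` level_cubes k"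

definition level_cube :: "nat \<Rightarrow> nat \<Rightarrow> (real ^ 'n) set" where
  "level_cube k = from_nat_into (level_cubes k)"

lemma level_cube_to_nat_on: "X \<in> level_cubes k \<Longrightarrow> level_cube k (to_nat_on (level_cubes k) X) = X"
  by (simp add: level_cube_def countable_level_cubes)

lemma level_union_level_cube: "level_union level_index level_cube k = level_set k"
  unfolding level_union_def level_index_def Union_level_cubes[symmetric]
  by (auto simp: level_cube_to_nat_on)

lemma sparse_level_cube: "sparse_family (cube a l) level_index level_cube"
  unfolding sparse_family_def level_union_level_cube
proof (intro conjI allI ballI)
  fix k
  show "level_set (Suc k) \<subseteq> level_set k" by (rule level_set_antimono)
  show "disjoint_family_on (level_cube k) (level_index k)"
    unfolding disjoint_family_on_def level_index_def
    using level_cubes_disjoint[of _ k] by (auto simp: level_cube_to_nat_on)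
  fix j assume "j \<in> level_index k"
  then have "level_cube k j \<in> level_cubes k"
    by (auto simp: level_index_def level_cube_to_nat_on)
  then obtain h x where hx: "level_cube k j = D h x" "x \<in> cube a l" "gen k x = Some h"
    by (auto simp: level_cubes_def)
  then show "level_cube k j \<in> dyadic_cubes (cube a l)" by (simp add: D_dyadic)
  have "level_set (Suc k) \<inter> D h x \<in> lmeasurable"
    using level_set_sets fmeasurable_Int_fmeasurable[OF D_lmeasurable] by (metis Int_commute)
  then show "measure lebesgue (level_set (Suc k) \<inter> level_cube k j) \<le> 1 / 2 * measure lebesgue (level_cube k j)"
    using emeasure_level_set_Int_D[OF hx(2,3)] unfolding hx(1)
    by (simp add: emeasure_eq_measure2 ennreal_mult[symmetric] del: ennreal_half)
qed

text \<open>The chain around \<open>x\<close> embeds into the index set, injectively since the level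
  is part of the index; the indicator is 1 on each of its cubes.\<close>

lemma sum_osc_le_infsum:
  assumes x: "x \<in> cube a l" and gen: "\<forall>i<K. gen i x \<noteq> None"
  shows "(\<Sum>i<K. osc (the (gen i x)) x) \<le> (\<Sum>\<^sub>\<infinity>(k, j)\<in>Sigma UNIV level_index.
    local_osc (1 / 2 ^ (CARD('n) + 2)) f (level_cube k j) * indicator (level_cube k j) x)"
    (is "_ \<le> infsum ?g _")
proof -
  define \<phi> where "\<phi> i = (i, to_nat_on (level_cubes i) (D (the (gen i x)) x))" for i
  have mem: "D (the (gen i x)) x \<in> level_cubes i" if i: "i < K" for i
  proof -
    obtain h where "gen i x = Some h" using gen i by blast
    then show ?thesis using x unfolding level_cubes_def by auto
  qed
  have "(\<Sum>i<K. osc (the (gen i x)) x) = (\<Sum>i<K. ?g (\<phi> i))"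
    by (rule sum.cong) (auto simp: \<phi>_def level_cube_to_nat_on[OF mem])
  also have "\<dots> = sum ?g (\<phi> ` {..<K})"
    by (rule sum.reindex_cong[symmetric, of \<phi>]) (auto simp: inj_on_def \<phi>_def)
  also have "\<dots> \<le> infsum ?g (Sigma UNIV level_index)"
    by (rule sum_le_infsum_ennreal) (use mem in \<open>auto simp: \<phi>_def level_index_def\<close>)
  finally show ?thesis .
qed

end

theorem theorem4p5:
  fixes f :: "real ^ 'n \<Rightarrow> real" and Q0 :: "(real ^ 'n) set"
  assumes "f \<in> borel_measurable lebesgue"
    and "is_cube Q0"
  shows "\<exists>J Q. sparse_family Q0 J Q \<and>
    (AE x in lebesgue. x \<in> Q0 \<longrightarrow>
      ennreal \<bar>f x - median f Q0\<bar>
        \<le> 4 * dyadic_sharp_max (1 / 2 ^ (CARD('n) + 2)) Q0 f x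
          + 2 * (\<Sum>\<^sub>\<infinity>(k, j)\<in>Sigma UNIV J.
                   local_osc (1 / 2 ^ (CARD('n) + 2)) f (Q k j) * indicator (Q k j) x))"
proof -
  obtain a l where Q0: "l > 0" "Q0 = cube a l"
    using assms(2) by (auto simp: is_cube_def)
  interpret local_osc_decomposition a l f
    by unfold_locales (use Q0 assms(1) in auto)
  have "AE x in lebesgue. x \<in> Q0 \<longrightarrow>
      ennreal \<bar>f x - median f Q0\<bar>
        \<le> 4 * dyadic_sharp_max (1 / 2 ^ (CARD('n) + 2)) Q0 f x
          + 2 * (\<Sum>\<^sub>\<infinity>(k, j)\<in>Sigma UNIV level_index.
                   local_osc (1 / 2 ^ (CARD('n) + 2)) f (level_cube k j) * indicator (level_cube k j) x)"
    (is "AE x in _. _ \<longrightarrow> _ \<le> ?M x + 2 * ?S x")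
    using AE_finite_levels
  proof (eventually_elim, intro impI)
    fix x
    assume *: "x \<notin> (\<Inter>k. level_set k) \<and> (\<forall>h. x \<notin> dev h x - cubes_union h x (stop h x))" "x \<in> Q0"
    then have x: "x \<in> cube a l" and n1: "x \<notin> (\<Inter>k. level_set k)"
      and n2: "x \<notin> dev h x - cubes_union h x (stop h x)" for h
      using Q0 by blast+
    obtain K where K: "\<forall>i<K. gen i x \<noteq> None"
      "ennreal \<bar>f x - median f (cube a l)\<bar> \<le> 2 * (\<Sum>i<K. osc (the (gen i x)) x)"
      using finite_levels_bound[OF x n1 n2] by blast
    note K(2)
    also have "2 * (\<Sum>i<K. osc (the (gen i x)) x) \<le> 2 * ?S x"
      by (intro mult_left_mono sum_osc_le_infsum x K(1)) simp_all
    \<comment> \<open>The oscillation on the last cube of the chain is already a term of the sum;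
      the maximal function enters by nonnegativity.\<close>
    also have "\<dots> \<le> ?M x + 2 * ?S x" by simp
    finally show "ennreal \<bar>f x - median f Q0\<bar> \<le> ?M x + 2 * ?S x"
      by (simp add: Q0)
  qed
  with sparse_level_cube show ?thesis unfolding Q0(2) by blast
qed

end
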